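(* For every integer $n\ge 0$, $$\mathrm{SONO}(5n+3)\equiv 0 \pmod 5.$$
   Context: An overpartition of a nonnegative integer $n$ is a partition of $n$ (a finite non-increasing sequence of positive integers with sum $n$) in which, for each part size that occurs, the first occurrence of that size may be overlined or not; equivalently, it is a pair consisting of a partition into distinct (overlined) parts and an unrestricted partition (the non-overlined parts) with total sum $n$. $\mathrm{SONO}(n)$ denotes the sum of all the odd non-overlined parts (counted with multiplicity) in all the overpartitions of $n$. *)

theory Defs
  imports "HOL-Library.FuncSet" "HOL-Library.Multiset" "HOL-Number_Theory.Cong"
begin

text \<open>An overpartition of \<open>n\<close> is a pair \<open>(D, M)\<close>: the overlined parts are distinct, hence form a
  finite set \<open>D\<close>; the non-overlined parts form a multiset \<open>M\<close>.\<close>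

definition overpartitions :: "nat \<Rightarrow> (nat set \<times> nat multiset) set" where
  "overpartitions n =
     {(D, M). finite D \<and> 0 \<notin> D \<and> 0 \<notin># M \<and> \<Sum>D + \<Sum>\<^sub># M = n}"

definition SONO :: "nat \<Rightarrow> nat" where
  "SONO n = (\<Sum>(D, M)\<in>overpartitions n. \<Sum>\<^sub># (filter_mset odd M))"

text \<open>The set of overpartitions is finite, so that the sum above is a genuine one.\<close>

lemma size_le_sum_mset:
  fixes M :: "nat multiset"
  assumes "0 \<notin># M"
  shows "size M \<le> \<Sum>\<^sub># M"
  using assms by (induction M) auto

lemma finite_overpartitions: "finite (overpartitions n)"
proof (rule finite_subset)
  let ?L = "{xs. set xs \<subseteq> {..n} \<and> length xs \<le> n}"
  show "finite (Pow {..n} \<times> mset ` ?L)"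
    by (simp add: finite_lists_length_le)
  show "overpartitions n \<subseteq> Pow {..n} \<times> mset ` ?L"
  proof clarify
    fix D M assume "(D, M) \<in> overpartitions n"
    then have *: "finite D" "0 \<notin># M" "\<Sum>D + \<Sum>\<^sub># M = n"
      by (auto simp: overpartitions_def)
    have "d \<le> n" if "d \<in> D" for d
      using member_le_sum[of d D "\<lambda>x. x"] that * by simp
    moreover obtain xs where xs: "M = mset xs"
      by (metis ex_mset)
    have "x \<le> n" if "x \<in> set xs" for x
      using member_le_sum_list[of x xs] that * xs by (simp add: sum_mset_sum_list)
    moreover have "length xs \<le> n"
      using size_le_sum_mset[of M] * xs by simp
    ultimately show "D \<in> Pow {..n} \<and> M \<in> mset ` ?L"
      using xs by auto
  qed
qed

lemma mset_set_subset_mset: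
  assumes "S \<subseteq> set_mset P"
  shows "mset_set S \<subseteq># P"
  using assms finite_subset[OF assms]
  by (auto simp: subseteq_mset_def count_mset_set' Suc_le_eq)

text \<open>Overpartitions as partitions \<open>P\<close> of \<open>n\<close> together with the set \<open>S\<close> of those part sizes whose
  first occurrence is overlined.\<close>

lemma bij_betw_overpartitions:
  "bij_betw (\<lambda>(P, S). (S, P - mset_set S))
     {(P, S). 0 \<notin># P \<and> \<Sum>\<^sub># P = n \<and> S \<subseteq> set_mset P} (overpartitions n)"
proof (rule bij_betwI[where g = "\<lambda>(D, M). (M + mset_set D, D)"])
  show "(\<lambda>(P, S). (S, P - mset_set S))
      \<in> {(P, S). 0 \<notin># P \<and> \<Sum>\<^sub># P = n \<and> S \<subseteq> set_mset P} \<rightarrow> overpartitions n"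
  proof clarify
    fix P :: "nat multiset" and S assume *: "0 \<notin># P" "n = \<Sum>\<^sub># P" "S \<subseteq> set_mset P"
    have "\<Sum>S + \<Sum>\<^sub># (P - mset_set S) = \<Sum>\<^sub># (mset_set S + (P - mset_set S))"
      by (simp add: sum_unfold_sum_mset)
    also have "\<dots> = \<Sum>\<^sub># P"
      using mset_set_subset_mset[OF *(3)] by simp
    finally show "(S, P - mset_set S) \<in> overpartitions (\<Sum>\<^sub># P)"
      using * finite_subset[OF *(3)] by (auto simp: overpartitions_def dest: in_diffD)
  qed
  show "(\<lambda>(D, M). (M + mset_set D, D))
      \<in> overpartitions n \<rightarrow> {(P, S). 0 \<notin># P \<and> \<Sum>\<^sub># P = n \<and> S \<subseteq> set_mset P}"
    by (auto simp: overpartitions_def sum_unfold_sum_mset)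
qed (auto simp: overpartitions_def mset_set_subset_mset)

end

theory Submission
  imports Defs "HOL-Computational_Algebra.Formal_Power_Series"
begin

text \<open>
  Let \<open>P\<close> be the generating function of the overpartitions, \<open>S = \<Sum> \<sigma>(n) q\<^sup>n\<close>,
  \<open>T = S(q\<^sup>2)\<close>, and \<open>\<theta> = q d/dq\<close>. Modulo \<open>5\<close> the operator \<open>\<theta> - 3\<close> kills
  every coefficient whose index is \<open>3\<close> modulo \<open>5\<close>. It is therefore enough to write the generating
  function of SONO, up to a unit modulo \<open>5\<close>, as \<open>\<theta>K - 3K\<close> for some series \<open>K\<close>.

  Removing copies of a fixed part \<open>k\<close> from overpartitions gives geometric series in \<open>q\<^sup>k\<close>. Summing
  them over \<open>k\<close> yields \<open>\<Sum> SONO(n) q\<^sup>n = (S - 2T) P\<close>, where \<open>S - 2T\<close> generates the sums of odd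
  divisors (lemma \<open>SONO_fps\<close>), and \<open>\<theta>P = 2 (S - T) P\<close>, the logarithmic derivative of
  \<open>P = \<Prod> (1 + q\<^sup>k) / (1 - q\<^sup>k)\<close> (lemma \<open>theta_overpartition_fps\<close>).

  Ramanujan's equation for \<open>\<theta>E\<^sub>2\<close> turns, because \<open>E\<^sub>4 \<equiv> 1\<close> modulo \<open>5\<close>, into
  \<open>\<theta>S \<equiv> 3S\<^sup>2 + S\<close>, hence \<open>\<theta>T \<equiv> T\<^sup>2 + 2T\<close>. So modulo \<open>5\<close> the derivation \<open>\<theta>\<close>
  maps polynomials in \<open>S\<close>, \<open>T\<close> times \<open>P\<close> to series of the same shape, and finding \<open>K = P L\<close>
  becomes linear algebra for a polynomial \<open>L\<close> in \<open>S\<close> and \<open>T\<close>. The choice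
  \<open>L = 2ST + T\<^sup>2 + S + T\<close> gives \<open>\<theta>K - 3K \<equiv> 3 (S - 2T) P\<close>
  (lemma \<open>theta_minus_3_mod_5\<close>).

  Ramanujan's equation amounts to the convolution formula
  \<open>12 \<Sum>\<^sub>k \<sigma>(k) \<sigma>(n - k) = 5 \<sigma>\<^sub>3(n) + \<sigma>(n) - 6 n \<sigma>(n)\<close>. It is proved here by
  elementary means, from a bijection between solutions of \<open>a x + b y = n\<close>
  (lemmas \<open>sum_solutions_descent\<close> and \<open>sigma_convolution\<close>).
\<close>

unbundle fps_syntax

section \<open>The derivation q d/dq\<close>

definition theta :: "int fps \<Rightarrow> int fps" where
  "theta f = fps_X * fps_deriv f"

lemma theta_nth: "theta f $ n = int n * f $ n"
  by (cases n) (simp_all add: theta_def)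

lemma theta_mult: "theta (f * g) = theta f * g + f * theta g"
  by (simp add: theta_def algebra_simps)

lemma theta_add: "theta (f + g) = theta f + theta g"
  by (simp add: theta_def algebra_simps)

lemma theta_compose_square: "theta (f oo fps_X ^ 2) = 2 * (theta f oo fps_X ^ 2)"
  by (simp add: theta_def fps_compose_deriv fps_compose_mult_distrib fps_deriv_power
      power2_eq_square algebra_simps)

section \<open>The convolution square of the divisor sum\<close>

text \<open>The bound \<open>{1..n}\<close> makes \<open>0\<close> have no divisors, so that all divisor sums vanish at \<open>0\<close> and
  their generating functions start with \<open>q\<close>.\<close>

definition divisors :: "nat \<Rightarrow> nat set" where
  "divisors n = {d \<in> {1..n}. d dvd n}"

lemma finite_divisors [simp]: "finite (divisors n)"
  by (simp add: divisors_def)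

definition sigma_pow :: "nat \<Rightarrow> nat \<Rightarrow> int" where
  "sigma_pow j n = (\<Sum>d\<in>divisors n. int d ^ j)"

text \<open>Grouped by \<open>k = a x\<close>, the solutions are pairs of a divisor of \<open>k\<close> and a divisor of \<open>n - k\<close>.
  They carry symmetries of the linear form that are invisible in the convolution itself.\<close>

definition solutions :: "nat \<Rightarrow> (nat \<times> nat \<times> nat \<times> nat) set" where
  "solutions n = {(a, b, x, y). 0 < a \<and> 0 < b \<and> 0 < x \<and> 0 < y \<and> a * x + b * y = n}"

lemma finite_solutions: "finite (solutions n)"
proof (rule finite_subset)
  have "a \<le> n \<and> b \<le> n \<and> x \<le> n \<and> y \<le> n" if "(a, b, x, y) \<in> solutions n" for a b x y
  proof -
    have pos: "0 < a" "0 < b" "0 < x" "0 < y" and eq: "a * x + b * y = n"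
      using that by (auto simp: solutions_def)
    have "a \<le> a * x" "x \<le> a * x" "b \<le> b * y" "y \<le> b * y"
      using pos by auto
    with eq show ?thesis
      by linarith
  qed
  then show "solutions n \<subseteq> {..n} \<times> {..n} \<times> {..n} \<times> {..n}"
    by auto
qed auto

lemma sum_solutions_eq_convolution:
  "(\<Sum>(a, b, x, y)\<in>solutions n. int a * int b) = (\<Sum>k\<le>n. sigma_pow 1 k * sigma_pow 1 (n - k))"
proof -
  have "(\<Sum>k\<le>n. sigma_pow 1 k * sigma_pow 1 (n - k))
      = (\<Sum>k\<le>n. \<Sum>(a, b)\<in>divisors k \<times> divisors (n - k). int a * int b)"
    by (simp add: sigma_pow_def sum_product sum.cartesian_product)
  also have "\<dots> = (\<Sum>(k, a, b)\<in>(SIGMA k:{..n}. divisors k \<times> divisors (n - k)). int a * int b)"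
    by (subst sum.Sigma) auto
  also have "\<dots> = (\<Sum>(a, b, x, y)\<in>solutions n. int a * int b)"
    by (rule sum.reindex_bij_witness[where
          i = "\<lambda>(a, b, x, y). (a * x, a, b)" and
          j = "\<lambda>(k, a, b). (a, b, k div a, (n - k) div b)"])
       (auto simp: solutions_def divisors_def div_greater_zero_iff Suc_le_eq)
  finally show ?thesis by simp
qed

text \<open>One step of the subtractive Euclidean algorithm: \<open>a x + b y = (a - b) x + b (x + y)\<close> is a
  bijection from the solutions with \<open>a > b\<close> onto those with \<open>x < y\<close>.\<close>

lemma sum_solutions_descent:
  "(\<Sum>(a, b, x, y)\<in>{(a, b, x, y) \<in> solutions n. b < a}. h (a - b) b :: int)
    = (\<Sum>(a, b, x, y)\<in>{(a, b, x, y) \<in> solutions n. x < y}. h a b)"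
proof -
  have down: "(a - b) * x + b * (x + y) = a * x + b * y" if "b < a" for a b x y :: nat
    using less_imp_add_positive[OF that] by (auto simp: algebra_simps)
  have up: "(a + b) * x + b * (y - x) = a * x + b * y" if "x < y" for a b x y :: nat
    using less_imp_add_positive[OF that] by (auto simp: algebra_simps)
  show ?thesis
    by (rule sum.reindex_bij_witness[where
          i = "\<lambda>(a, b, x, y). (a + b, b, x, y - x)" and
          j = "\<lambda>(a, b, x, y). (a - b, b, x, x + y)"])
       (auto simp: solutions_def down up)
qed

text \<open>The exchange \<open>(a, x) \<leftrightarrow> (b, y)\<close> preserves a symmetric summand and swaps the two sides of either
  comparison. Both regions of the descent are thus half of the full sum, up to a diagonal.\<close>

lemma sum_solutions_symmetric:
  fixes h :: "nat \<Rightarrow> nat \<Rightarrow> int"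
  assumes "\<And>a b. h a b = h b a"
  shows "(\<Sum>(a, b, x, y)\<in>solutions n. h a b)
      = 2 * (\<Sum>(a, b, x, y)\<in>{(a, b, x, y) \<in> solutions n. b < a}. h a b)
        + (\<Sum>(a, b, x, y)\<in>{(a, b, x, y) \<in> solutions n. a = b}. h a b)" (is ?A)
    and "(\<Sum>(a, b, x, y)\<in>solutions n. h a b)
      = 2 * (\<Sum>(a, b, x, y)\<in>{(a, b, x, y) \<in> solutions n. x < y}. h a b)
        + (\<Sum>(a, b, x, y)\<in>{(a, b, x, y) \<in> solutions n. x = y}. h a b)" (is ?B)
proof -
  \<comment> \<open>\<open>Q\<close>, its mirror image under the exchange, and \<open>E\<close> form a trichotomy.\<close>
  have split: "(\<Sum>(a, b, x, y)\<in>solutions n. h a b)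
      = (\<Sum>(a, b, x, y)\<in>{(a, b, x, y) \<in> solutions n. Q a b x y}. h a b)
        + (\<Sum>(a, b, x, y)\<in>{(a, b, x, y) \<in> solutions n. Q b a y x}. h a b)
        + (\<Sum>(a, b, x, y)\<in>{(a, b, x, y) \<in> solutions n. E a b x y}. h a b)"
    if tri: "\<And>a b x y. Q a b x y \<or> Q b a y x \<or> E a b x y"
      "\<And>a b x y. Q a b x y \<Longrightarrow> \<not> Q b a y x \<and> \<not> E a b x y"
      "\<And>a b x y. Q b a y x \<Longrightarrow> \<not> E a b x y"
    for Q E :: "nat \<Rightarrow> nat \<Rightarrow> nat \<Rightarrow> nat \<Rightarrow> bool"
  proof -
    have fin: "finite {(a, b, x, y) \<in> solutions n. R a b x y}" for R
      by (rule finite_subset[OF _ finite_solutions]) auto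
    have "solutions n = {(a, b, x, y) \<in> solutions n. Q a b x y}
        \<union> {(a, b, x, y) \<in> solutions n. Q b a y x} \<union> {(a, b, x, y) \<in> solutions n. E a b x y}"
      using tri(1) by auto
    then have "sum f (solutions n) = sum f ({(a, b, x, y) \<in> solutions n. Q a b x y}
        \<union> {(a, b, x, y) \<in> solutions n. Q b a y x} \<union> {(a, b, x, y) \<in> solutions n. E a b x y})"
      for f :: "_ \<Rightarrow> int"
      by simp
    moreover have "({(a, b, x, y) \<in> solutions n. Q a b x y} \<union> {(a, b, x, y) \<in> solutions n. Q b a y x})
        \<inter> {(a, b, x, y) \<in> solutions n. E a b x y} = {}"
      using tri(2,3) by blast
    moreover have "{(a, b, x, y) \<in> solutions n. Q a b x y}
        \<inter> {(a, b, x, y) \<in> solutions n. Q b a y x} = {}"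
      using tri(2) by blast
    ultimately show ?thesis
      by (simp add: sum.union_disjoint fin)
  qed
  have swap: "(\<Sum>(a, b, x, y)\<in>{(a, b, x, y) \<in> solutions n. Q b a y x}. h a b)
      = (\<Sum>(a, b, x, y)\<in>{(a, b, x, y) \<in> solutions n. Q a b x y}. h a b)"
    for Q :: "nat \<Rightarrow> nat \<Rightarrow> nat \<Rightarrow> nat \<Rightarrow> bool"
    by (rule sum.reindex_bij_witness[where
          i = "\<lambda>(a, b, x, y). (b, a, y, x)" and j = "\<lambda>(a, b, x, y). (b, a, y, x)"])
       (auto simp: solutions_def assms add.commute)
  have "(\<Sum>(a, b, x, y)\<in>solutions n. h a b)
      = (\<Sum>(a, b, x, y)\<in>{(a, b, x, y) \<in> solutions n. b < a}. h a b)
        + (\<Sum>(a, b, x, y)\<in>{(a, b, x, y) \<in> solutions n. a < b}. h a b)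
        + (\<Sum>(a, b, x, y)\<in>{(a, b, x, y) \<in> solutions n. a = b}. h a b)"
    by (rule split[of "\<lambda>a b x y. b < a" "\<lambda>a b x y. a = b"]) auto
  with swap[of "\<lambda>a b x y. b < a"] show ?A
    by simp
  have "(\<Sum>(a, b, x, y)\<in>solutions n. h a b)
      = (\<Sum>(a, b, x, y)\<in>{(a, b, x, y) \<in> solutions n. x < y}. h a b)
        + (\<Sum>(a, b, x, y)\<in>{(a, b, x, y) \<in> solutions n. y < x}. h a b)
        + (\<Sum>(a, b, x, y)\<in>{(a, b, x, y) \<in> solutions n. x = y}. h a b)"
    by (rule split[of "\<lambda>a b x y. x < y" "\<lambda>a b x y. x = y"]) auto
  with swap[of "\<lambda>a b x y. x < y"] show ?B
    by simp
qed

text \<open>On the diagonal \<open>a = b = d\<close> the equation reads \<open>d (x + y) = n\<close>, which leaves \<open>n div d - 1\<close>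
  choices of \<open>x\<close> for each divisor \<open>d\<close>.\<close>

lemma sum_solutions_diagonal_divisor:
  "(\<Sum>(a, b, x, y)\<in>{(a, b, x, y) \<in> solutions n. a = b}. h a b :: int)
    = (\<Sum>d\<in>divisors n. (int (n div d) - 1) * h d d)"
proof -
  have le: "d * x \<le> n" if "x < n div d" for d x
    using that by (meson le_trans less_imp_le mult_le_mono2 times_div_less_eq_dividend)
  have "(\<Sum>d\<in>divisors n. (int (n div d) - 1) * h d d)
      = (\<Sum>d\<in>divisors n. \<Sum>x\<in>{1..<n div d}. h d d)"
    by (rule sum.cong) (auto simp: divisors_def div_greater_zero_iff Suc_le_eq of_nat_diff)
  also have "\<dots> = (\<Sum>(d, x)\<in>(SIGMA d:divisors n. {1..<n div d}). h d d)"
    by (subst sum.Sigma) auto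
  also have "\<dots> = (\<Sum>(a, b, x, y)\<in>{(a, b, x, y) \<in> solutions n. a = b}. h a b)"
    by (rule sum.reindex_bij_witness[where
          i = "\<lambda>(a, b, x, y). (a, x)" and
          j = "\<lambda>(d, x). (d, d, x, n div d - x)"])
       (auto simp: solutions_def divisors_def diff_mult_distrib2 le simp flip: add_mult_distrib2)
  finally show ?thesis by simp
qed

text \<open>On the other diagonal the equation reads \<open>(a + b) x = n\<close>, so \<open>d = a + b\<close> runs through the
  divisors of \<open>n\<close> and is split into two positive summands.\<close>

lemma sum_solutions_diagonal_codivisor:
  "(\<Sum>(a, b, x, y)\<in>{(a, b, x, y) \<in> solutions n. x = y}. h a b :: int)
    = (\<Sum>d\<in>divisors n. \<Sum>a\<in>{1..<d}. h a (d - a))"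
proof -
  have "(\<Sum>d\<in>divisors n. \<Sum>a\<in>{1..<d}. h a (d - a))
      = (\<Sum>(d, a)\<in>(SIGMA d:divisors n. {1..<d}). h a (d - a))"
    by (subst sum.Sigma) auto
  also have "\<dots> = (\<Sum>(a, b, x, y)\<in>{(a, b, x, y) \<in> solutions n. x = y}. h a b)"
    by (rule sum.reindex_bij_witness[where
          i = "\<lambda>(a, b, x, y). (a + b, a)" and
          j = "\<lambda>(d, a). (a, d - a, n div d, n div d)"])
       (auto simp: solutions_def divisors_def div_greater_zero_iff Suc_le_eq
          simp flip: add_mult_distrib)
  finally show ?thesis by simp
qed

lemma sum_binary_quadratic_form:
  "6 * (\<Sum>a\<in>{1..<d}. int a ^ 2 + int a * int (d - a) + int (d - a) ^ 2)
    = 5 * int d ^ 3 - 6 * int d ^ 2 + int d"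
proof (cases "d = 0")
  case False
  \<comment> \<open>The coefficient \<open>c\<close> is decoupled from the range, since the induction must keep it fixed.\<close>
  have "6 * (\<Sum>a\<in>{1..<Suc m}. c ^ 2 - c * int a + int a ^ 2)
      = 6 * c ^ 2 * int m - 3 * c * int m * (int m + 1) + int m * (int m + 1) * (2 * int m + 1)"
    for c and m :: nat
    by (induction m) (simp_all add: algebra_simps power2_eq_square)
  from this[of "int d" "d - 1"] False
  have "6 * (\<Sum>a\<in>{1..<d}. int d ^ 2 - int d * int a + int a ^ 2)
      = 5 * int d ^ 3 - 6 * int d ^ 2 + int d"
    by (simp add: of_nat_diff algebra_simps power2_eq_square power3_eq_cube)
  also have "(\<Sum>a\<in>{1..<d}. int d ^ 2 - int d * int a + int a ^ 2)
      = (\<Sum>a\<in>{1..<d}. int a ^ 2 + int a * int (d - a) + int (d - a) ^ 2)"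
    by (rule sum.cong) (auto simp: of_nat_diff algebra_simps power2_eq_square)
  finally show ?thesis .
qed simp

text \<open>The form \<open>a\<^sup>2 + a b + b\<^sup>2\<close> becomes \<open>a\<^sup>2 - a b + b\<^sup>2\<close> under \<open>a \<mapsto> a - b\<close>. By the descent,
  the sum of the second form over \<open>a > b\<close> equals the sum of the first over \<open>x < y\<close>. By symmetry,
  these are halves of the full sums up to the diagonals. The two full sums differ by twice the sum
  of \<open>a b\<close>, which is therefore the difference of the diagonal sums.\<close>

lemma sigma_convolution:
  "12 * (\<Sum>k\<le>n. sigma_pow 1 k * sigma_pow 1 (n - k))
    = 5 * sigma_pow 3 n + sigma_pow 1 n - 6 * int n * sigma_pow 1 n"
proof -
  define W where "W = (\<Sum>(a, b, x, y)\<in>solutions n. int a * int b)"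
  define qp where "qp a b = int a ^ 2 + int a * int b + int b ^ 2" for a b
  define qm where "qm a b = int a ^ 2 - int a * int b + int b ^ 2" for a b
  have "(\<Sum>(a, b, x, y)\<in>{(a, b, x, y) \<in> solutions n. b < a}. qm a b)
      = (\<Sum>(a, b, x, y)\<in>{(a, b, x, y) \<in> solutions n. b < a}. qp (a - b) b)"
    by (rule sum.cong) (auto simp: qm_def qp_def of_nat_diff algebra_simps power2_eq_square)
  also have "\<dots> = (\<Sum>(a, b, x, y)\<in>{(a, b, x, y) \<in> solutions n. x < y}. qp a b)"
    by (rule sum_solutions_descent)
  finally have eq: "(\<Sum>(a, b, x, y)\<in>{(a, b, x, y) \<in> solutions n. b < a}. qm a b)
      = (\<Sum>(a, b, x, y)\<in>{(a, b, x, y) \<in> solutions n. x < y}. qp a b)" .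
  have "(\<Sum>(a, b, x, y)\<in>solutions n. qp a b) - (\<Sum>(a, b, x, y)\<in>solutions n. qm a b)
      = (\<Sum>(a, b, x, y)\<in>solutions n. 2 * (int a * int b))"
    unfolding sum_subtractf[symmetric]
    by (rule sum.cong) (auto simp: qp_def qm_def)
  also have "\<dots> = 2 * W"
    by (simp add: W_def sum_distrib_left case_prod_unfold)
  finally have "2 * W = (\<Sum>(a, b, x, y)\<in>{(a, b, x, y) \<in> solutions n. x = y}. qp a b)
      - (\<Sum>(a, b, x, y)\<in>{(a, b, x, y) \<in> solutions n. a = b}. qm a b)"
    using eq sum_solutions_symmetric(2)[of qp n] sum_solutions_symmetric(1)[of qm n]
    by (simp add: qp_def qm_def algebra_simps)
  also have "\<dots> = (\<Sum>d\<in>divisors n. \<Sum>a\<in>{1..<d}. qp a (d - a))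
      - (\<Sum>d\<in>divisors n. (int (n div d) - 1) * int d ^ 2)"
    by (simp add: sum_solutions_diagonal_codivisor sum_solutions_diagonal_divisor qm_def
        power2_eq_square)
  finally have "12 * W = (\<Sum>d\<in>divisors n. 6 * (\<Sum>a\<in>{1..<d}. qp a (d - a))
      - 6 * ((int (n div d) - 1) * int d ^ 2))"
    by (simp add: sum_subtractf flip: sum_distrib_left)
  also have "\<dots> = (\<Sum>d\<in>divisors n. 5 * int d ^ 3 + int d ^ 1 - 6 * int n * int d ^ 1)"
  proof (rule sum.cong)
    fix d assume "d \<in> divisors n"
    then have "int n = int d * int (n div d)"
      by (auto simp: divisors_def simp flip: of_nat_mult)
    then show "6 * (\<Sum>a\<in>{1..<d}. qp a (d - a)) - 6 * ((int (n div d) - 1) * int d ^ 2)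
        = 5 * int d ^ 3 + int d ^ 1 - 6 * int n * int d ^ 1"
      unfolding qp_def sum_binary_quadratic_form by (simp add: algebra_simps power2_eq_square)
  qed simp
  also have "\<dots> = 5 * sigma_pow 3 n + sigma_pow 1 n - 6 * int n * sigma_pow 1 n"
    unfolding sigma_pow_def by (simp add: sum.distrib sum_subtractf sum_distrib_left)
  finally show ?thesis
    by (simp add: W_def sum_solutions_eq_convolution)
qed

section \<open>The differential equations modulo 5\<close>

definition sigma_fps :: "int fps" where
  "sigma_fps = Abs_fps (sigma_pow 1)"

text \<open>The convolution formula says \<open>12 S\<^sup>2 = 5 S\<^sub>3 + S - 6 \<theta>S\<close>, and \<open>12 \<equiv> -3\<close>, \<open>6 \<equiv> 1\<close> modulo
  \<open>5\<close>. The congruence is expressed by an explicit multiple of \<open>5\<close>, so that it can be substituted in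
  ring identities over the integers.\<close>

lemma theta_sigma_fps:
  "\<exists>U. theta sigma_fps = 3 * sigma_fps ^ 2 + sigma_fps + 5 * U"
proof -
  let ?U = "Abs_fps (sigma_pow 3) - 3 * sigma_fps ^ 2 - theta sigma_fps"
  have "12 * sigma_fps ^ 2 = 5 * Abs_fps (sigma_pow 3) + sigma_fps - 6 * theta sigma_fps"
  proof (rule fps_ext)
    fix n
    have "(sigma_fps ^ 2) $ n = (\<Sum>k\<le>n. sigma_pow 1 k * sigma_pow 1 (n - k))"
      by (simp add: power2_eq_square fps_mult_nth sigma_fps_def atLeast0AtMost)
    then show "(12 * sigma_fps ^ 2) $ n
        = (5 * Abs_fps (sigma_pow 3) + sigma_fps - 6 * theta sigma_fps) $ n"
      using sigma_convolution[of n]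
      by (simp add: numeral_fps_const theta_nth sigma_fps_def)
  qed
  then have "theta sigma_fps = 3 * sigma_fps ^ 2 + sigma_fps + 5 * ?U"
    by (simp add: algebra_simps)
  then show ?thesis ..
qed

definition sigma2_fps :: "int fps" where
  "sigma2_fps = sigma_fps oo fps_X ^ 2"

lemma sigma2_fps_nth: "sigma2_fps $ n = (if even n then sigma_pow 1 (n div 2) else 0)"
proof -
  have "sigma2_fps $ n = (\<Sum>i=0..n. if n = 2 * i then sigma_pow 1 i else 0)"
    by (simp add: sigma2_fps_def fps_compose_nth sigma_fps_def if_distrib cong: if_cong
        flip: power_mult)
  also have "\<dots> = (\<Sum>i=0..n. if i = n div 2 then if even n then sigma_pow 1 i else 0 else 0)"
    by (rule sum.cong) auto
  finally show ?thesis
    by simp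
qed

text \<open>Substituting \<open>q\<^sup>2\<close> doubles the derivative, so \<open>\<theta>T \<equiv> 2 (3T\<^sup>2 + T)\<close>.\<close>

lemma theta_sigma2_fps:
  "\<exists>V. theta sigma2_fps = sigma2_fps ^ 2 + 2 * sigma2_fps + 5 * V"
proof -
  obtain U where U: "theta sigma_fps = 3 * sigma_fps ^ 2 + sigma_fps + 5 * U"
    using theta_sigma_fps by blast
  have "theta sigma2_fps = 2 * ((3 * sigma_fps ^ 2 + sigma_fps + 5 * U) oo fps_X ^ 2)"
    by (simp add: sigma2_fps_def theta_compose_square U)
  also have "\<dots> = 2 * (3 * sigma2_fps ^ 2 + sigma2_fps + 5 * (U oo fps_X ^ 2))"
    by (simp add: sigma2_fps_def fps_compose_add_distrib fps_compose_mult_distrib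
        power2_eq_square numeral_fps_const)
  also have "\<dots> = sigma2_fps ^ 2 + 2 * sigma2_fps + 5 * (sigma2_fps ^ 2 + 2 * (U oo fps_X ^ 2))"
    by (simp add: algebra_simps)
  finally show ?thesis ..
qed

section \<open>Occurrences of a fixed part in overpartitions\<close>

lemma overpartition_parts_bounded:
  assumes "(D, M) \<in> overpartitions n"
  shows "D \<subseteq> {1..n}" "set_mset M \<subseteq> {1..n}"
proof -
  have *: "finite D" "0 \<notin> D" "0 \<notin># M" "\<Sum>D + \<Sum>\<^sub># M = n"
    using assms by (auto simp: overpartitions_def)
  have "d \<le> n" if "d \<in> D" for d
    using member_le_sum[of d D "\<lambda>x. x"] that * by simp
  with *(2) show "D \<subseteq> {1..n}"
    by (auto simp: Suc_le_eq intro: gr0I)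
  have "k \<le> n" if "k \<in># M" for k
    using sum_mset.remove[OF that] *(4) by simp
  with *(3) show "set_mset M \<subseteq> {1..n}"
    by (auto simp: Suc_le_eq intro: gr0I)
qed

definition overpartition_fps :: "int fps" where
  "overpartition_fps = Abs_fps (\<lambda>n. int (card (overpartitions n)))"

text \<open>The geometric series \<open>q\<^sup>k / (1 - q\<^sup>k)\<close>.\<close>

definition multiples_fps :: "nat \<Rightarrow> int fps" where
  "multiples_fps k = Abs_fps (\<lambda>m. if 0 < m \<and> k dvd m then 1 else 0)"

lemma multiples_fps_eq:
  assumes "0 < k"
  shows "(1 - fps_X ^ k) * multiples_fps k = fps_X ^ k"
proof (rule fps_ext)
  fix n show "((1 - fps_X ^ k) * multiples_fps k) $ n = (fps_X ^ k :: int fps) $ n"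
    using assms
    by (auto simp: algebra_simps fps_X_power_mult_nth multiples_fps_def dvd_minus_self
        dest: dvd_imp_le)
qed

lemma fps_one_minus_X_power_neq_0:
  assumes "0 < k"
  shows "1 - fps_X ^ k \<noteq> (0 :: int fps)"
proof
  assume "1 - fps_X ^ k = (0 :: int fps)"
  then have "(1 - fps_X ^ k :: int fps) $ 0 = 0" by simp
  with assms show False by simp
qed

lemma solve_linear_equation:
  fixes x :: "'a :: comm_ring_1"
  assumes "x = q * (p + c * x)"
  shows "(1 - q * c) * x = q * p"
proof -
  have "(1 - q * c) * x = x - q * (c * x)"
    by (simp add: algebra_simps)
  also have "\<dots> = q * (p + c * x) - q * (c * x)"
    by (simp only: assms[symmetric])
  finally show ?thesis
    by (simp add: algebra_simps)
qed

text \<open>Removing one non-overlined \<open>k\<close> maps the overpartitions of \<open>n\<close> that contain one bijectively to all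
  overpartitions of \<open>n - k\<close> and lowers the multiplicity by one. The series \<open>C\<close> of multiplicities
  therefore satisfies \<open>C = q\<^sup>k (P + C)\<close>.\<close>

lemma count_fps_eq:
  assumes "0 < k"
  shows "Abs_fps (\<lambda>n. \<Sum>(D, M)\<in>overpartitions n. int (count M k))
    = multiples_fps k * overpartition_fps" (is "?C = _")
proof -
  have "?C = fps_X ^ k * (overpartition_fps + ?C)"
  proof (rule fps_ext)
    fix n
    show "?C $ n = (fps_X ^ k * (overpartition_fps + ?C)) $ n"
    proof (cases "n < k")
      case True
      have "count M k = 0" if "(D, M) \<in> overpartitions n" for D M
        using overpartition_parts_bounded(2)[OF that] True by (auto simp: count_eq_zero_iff)
      then show ?thesis
        using True by (auto simp: fps_X_power_mult_nth intro!: sum.neutral)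
    next
      case False
      have insert_part: "(D, add_mset k M) \<in> overpartitions n" if "(D, M) \<in> overpartitions (n - k)" for D M
        using that False assms by (auto simp: overpartitions_def)
      have remove_part: "(D, M - {#k#}) \<in> overpartitions (n - k)"
        if "(D, M) \<in> overpartitions n" "k \<in># M" for D M
      proof -
        obtain M' where "M = add_mset k M'"
          using multi_member_split[OF \<open>k \<in># M\<close>] by blast
        with that(1) show ?thesis
          by (auto simp: overpartitions_def)
      qed
      have "?C $ n = (\<Sum>(D, M)\<in>{(D, M) \<in> overpartitions n. k \<in># M}. int (count M k))"
        by (auto simp: finite_overpartitions not_in_iff intro!: sum.mono_neutral_right)
      also have "\<dots> = (\<Sum>(D, M)\<in>overpartitions (n - k). 1 + int (count M k))"
        by (rule sum.reindex_bij_witness[where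
              i = "\<lambda>(D, M). (D, add_mset k M)" and j = "\<lambda>(D, M). (D, M - {#k#})"])
           (clarsimp simp: insert_part remove_part Suc_le_eq of_nat_diff)+
      also have "\<dots> = int (card (overpartitions (n - k)))
          + (\<Sum>(D, M)\<in>overpartitions (n - k). int (count M k))"
        by (simp add: case_prod_unfold sum.distrib)
      finally show ?thesis
        using False by (simp add: fps_X_power_mult_nth overpartition_fps_def)
    qed
  qed
  then have "(1 - fps_X ^ k * 1) * ?C = fps_X ^ k * overpartition_fps"
    by (intro solve_linear_equation) simp
  then have "(1 - fps_X ^ k) * ?C = fps_X ^ k * overpartition_fps"
    by simp
  also have "\<dots> = (1 - fps_X ^ k) * (multiples_fps k * overpartition_fps)"
    by (simp add: multiples_fps_eq[OF assms] flip: mult.assoc)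
  finally show ?thesis
    using fps_one_minus_X_power_neq_0[OF assms] by simp
qed

text \<open>Removing an overlined \<open>k\<close> leaves an overpartition without overlined \<open>k\<close>, so the counting series
  satisfies \<open>N = q\<^sup>k (P - N)\<close>. The factor on the right is
  \<open>q\<^sup>k / (1 + q\<^sup>k) = q\<^sup>k / (1 - q\<^sup>k) - 2 q\<^sup>2\<^sup>k / (1 - q\<^sup>2\<^sup>k)\<close>, written so that the sum over
  \<open>k\<close> produces ordinary divisor sums.\<close>

lemma overlined_fps_eq:
  assumes "0 < k"
  shows "Abs_fps (\<lambda>n. \<Sum>(D, M)\<in>overpartitions n. if k \<in> D then 1 else 0)
    = (multiples_fps k - 2 * multiples_fps (2 * k)) * overpartition_fps" (is "?N = _")
proof -
  have "?N = fps_X ^ k * (overpartition_fps - ?N)"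
  proof (rule fps_ext)
    fix n
    show "?N $ n = (fps_X ^ k * (overpartition_fps - ?N)) $ n"
    proof (cases "n < k")
      case True
      have "k \<notin> D" if "(D, M) \<in> overpartitions n" for D M
        using overpartition_parts_bounded(1)[OF that] True by auto
      then show ?thesis
        using True by (auto simp: fps_X_power_mult_nth intro!: sum.neutral)
    next
      case False
      have "?N $ n = (\<Sum>(D, M)\<in>{(D, M) \<in> overpartitions n. k \<in> D}. 1)"
        unfolding fps_nth_Abs_fps
        by (rule sum.mono_neutral_cong_right)
           (auto simp: finite_overpartitions split: if_splits)
      also have "\<dots> = (\<Sum>(D, M)\<in>{(D, M) \<in> overpartitions (n - k). k \<notin> D}. 1)"
        by (rule sum.reindex_bij_witness[where
              i = "\<lambda>(D, M). (insert k D, M)" and j = "\<lambda>(D, M). (D - {k}, M)"])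
           (use False assms in \<open>auto simp: overpartitions_def sum.remove\<close>)
      also have "\<dots> = (\<Sum>(D, M)\<in>overpartitions (n - k). 1 - (if k \<in> D then 1 else 0))"
        by (rule sum.mono_neutral_cong_left) (auto simp: finite_overpartitions)
      also have "\<dots> = int (card (overpartitions (n - k)))
          - (\<Sum>(D, M)\<in>overpartitions (n - k). if k \<in> D then 1 else 0)"
        by (simp add: case_prod_unfold sum_subtractf)
      finally show ?thesis
        using False by (simp add: fps_X_power_mult_nth overpartition_fps_def)
    qed
  qed
  then have "(1 - fps_X ^ k * - 1) * ?N = fps_X ^ k * overpartition_fps"
    by (intro solve_linear_equation) simp
  then have N: "(1 + fps_X ^ k) * ?N = fps_X ^ k * overpartition_fps"
    by simp
  have factor: "1 - fps_X ^ (2 * k) = (1 - fps_X ^ k) * (1 + fps_X ^ k :: int fps)"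
    unfolding power_even_eq by (simp add: algebra_simps power2_eq_square)
  let ?G = "multiples_fps k" and ?H = "multiples_fps (2 * k)" and ?q = "fps_X ^ k :: int fps"
  have G: "(1 - ?q) * ?G = ?q"
    using multiples_fps_eq[OF assms] .
  have H: "(1 - ?q) * (1 + ?q) * ?H = ?q ^ 2"
    using multiples_fps_eq[of "2 * k", unfolded factor, unfolded power_even_eq] assms by simp
  have "(1 - fps_X ^ (2 * k)) * ?N = (1 - ?q) * ((1 + ?q) * ?N)"
    by (simp only: factor mult.assoc)
  also have "\<dots> = (?q - ?q ^ 2) * overpartition_fps"
    unfolding N by (simp add: algebra_simps power2_eq_square)
  also have "?q - ?q ^ 2 = (1 + ?q) * ((1 - ?q) * ?G) - 2 * ((1 - ?q) * (1 + ?q) * ?H)"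
    unfolding G H by (simp add: algebra_simps power2_eq_square)
  also have "\<dots> = (1 - fps_X ^ (2 * k)) * (?G - 2 * ?H)"
    unfolding factor by (simp add: algebra_simps)
  finally show ?thesis
    using fps_one_minus_X_power_neq_0[of "2 * k"] assms by (simp add: mult.assoc)
qed


section \<open>Summation over all parts\<close>

definition divisor_sum_fps :: "(nat \<Rightarrow> int) \<Rightarrow> int fps" where
  "divisor_sum_fps w = Abs_fps (\<lambda>n. \<Sum>d\<in>divisors n. w d)"

lemma sigma_fps_eq_divisor_sum: "sigma_fps = divisor_sum_fps int"
  by (rule fps_ext) (simp add: sigma_fps_def divisor_sum_fps_def sigma_pow_def)

text \<open>The even divisors of \<open>2 m\<close> are the doubles of the divisors of \<open>m\<close>.\<close>

lemma even_divisor_sum_fps: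
  "divisor_sum_fps (\<lambda>d. if even d then int d else 0) = 2 * sigma2_fps"
proof (rule fps_ext)
  fix n
  have "(\<Sum>d\<in>divisors n. if even d then int d else 0) = (\<Sum>d\<in>{d\<in>divisors n. even d}. int d)"
    by (rule sum.mono_neutral_cong_right) auto
  also have "\<dots> = (if even n then \<Sum>d\<in>divisors (n div 2). 2 * int d else 0)"
  proof (cases "even n")
    case True
    then obtain m where m: "n = 2 * m" ..
    have "(\<Sum>d\<in>{d\<in>divisors n. even d}. int d) = (\<Sum>d\<in>divisors m. 2 * int d)"
      by (rule sum.reindex_bij_witness[where i = "\<lambda>d. 2 * d" and j = "\<lambda>d. d div 2"])
         (auto simp: divisors_def m elim!: evenE)
    then show ?thesis
      by (simp add: m)
  next
    case False
    then have "{d\<in>divisors n. even d} = {}"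
      by (auto simp: divisors_def)
    with False show ?thesis
      by (simp only: if_False sum.empty)
  qed
  finally show "divisor_sum_fps (\<lambda>d. if even d then int d else 0) $ n = (2 * sigma2_fps) $ n"
    by (simp add: divisor_sum_fps_def sigma2_fps_nth sigma_pow_def numeral_fps_const
        sum_distrib_left)
qed

lemma odd_divisor_sum_fps:
  "divisor_sum_fps (\<lambda>d. if odd d then int d else 0) = sigma_fps - 2 * sigma2_fps"
  unfolding even_divisor_sum_fps[symmetric] sigma_fps_eq_divisor_sum
  by (rule fps_ext) (auto simp: divisor_sum_fps_def simp flip: sum_subtractf intro!: sum.cong)

text \<open>A finite form of the Lambert series identity
  \<open>\<Sum>\<^sub>k w(k) q\<^sup>k / (1 - q\<^sup>k) = \<Sum>\<^sub>n (\<Sum>\<^sub>d w(d)) q\<^sup>n\<close>, with \<open>d\<close> running through the divisors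
  of \<open>n\<close>: the terms with \<open>k > n\<close> do not reach the coefficient of \<open>q\<^sup>n\<close>. The free bound \<open>N\<close>
  allows sums over \<open>2 k\<close> with \<open>k \<le> n\<close>.\<close>

lemma weighted_sum_multiples_fps:
  assumes "n \<le> N"
  shows "(\<Sum>k\<in>{1..N}. w k * (multiples_fps k * f) $ n) = (divisor_sum_fps w * f) $ n"
proof -
  have "(\<Sum>k\<in>{1..N}. w k * (multiples_fps k * f) $ n)
      = (\<Sum>i=0..n. (\<Sum>k\<in>{1..N}. w k * multiples_fps k $ i) * f $ (n - i))"
    by (simp add: fps_mult_nth sum_distrib_left sum_distrib_right mult.assoc) (rule sum.swap)
  also have "\<dots> = (\<Sum>i=0..n. divisor_sum_fps w $ i * f $ (n - i))"
  proof (rule sum.cong)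
    fix i assume "i \<in> {0..n}"
    then have "(\<Sum>k\<in>{1..N}. w k * multiples_fps k $ i) = (\<Sum>d\<in>divisors i. w d)"
      using assms
      by (intro sum.mono_neutral_cong_right)
         (auto simp: divisors_def multiples_fps_def dest: dvd_imp_le)
    then show "(\<Sum>k\<in>{1..N}. w k * multiples_fps k $ i) * f $ (n - i)
        = divisor_sum_fps w $ i * f $ (n - i)"
      by (simp add: divisor_sum_fps_def)
  qed simp
  finally show ?thesis
    by (simp add: fps_mult_nth)
qed

lemma sum_mset_eq_sum_count:
  fixes M :: "nat multiset"
  assumes "finite K" "set_mset M \<subseteq> K"
  shows "\<Sum>\<^sub># M = (\<Sum>k\<in>K. k * count M k)"
  using assms(2)
proof (induction M)
  case (add x M)
  then have "(\<Sum>k\<in>K. k * count (add_mset x M) k) = (\<Sum>k\<in>K. k * count M k + (if k = x then k else 0))"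
    by (intro sum.cong) auto
  with add assms(1) show ?case
    by (simp add: sum.distrib)
qed simp

lemma SONO_fps:
  "Abs_fps (\<lambda>n. int (SONO n)) = (sigma_fps - 2 * sigma2_fps) * overpartition_fps"
proof (rule fps_ext)
  fix n
  let ?w = "\<lambda>d. if odd d then int d else 0"
  have *: "int (\<Sum>\<^sub># (filter_mset odd M)) = (\<Sum>k\<in>{1..n}. ?w k * int (count M k))"
    if "(D, M) \<in> overpartitions n" for D M
  proof -
    have "set_mset (filter_mset odd M) \<subseteq> {1..n}"
      using overpartition_parts_bounded(2)[OF that] by auto
    from sum_mset_eq_sum_count[OF _ this] show ?thesis
      by (auto intro!: sum.cong)
  qed
  have "int (SONO n) = (\<Sum>(D, M)\<in>overpartitions n. \<Sum>k\<in>{1..n}. ?w k * int (count M k))"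
    unfolding SONO_def of_nat_sum case_prod_unfold
  proof (rule sum.cong[OF refl])
    fix p assume "p \<in> overpartitions n"
    then show "int (\<Sum>\<^sub># (filter_mset odd (snd p))) = (\<Sum>k\<in>{1..n}. ?w k * int (count (snd p) k))"
      by (intro *[of "fst p"]) simp
  qed
  also have "\<dots> = (\<Sum>k\<in>{1..n}. ?w k * (\<Sum>(D, M)\<in>overpartitions n. int (count M k)))"
    unfolding case_prod_unfold sum_distrib_left by (rule sum.swap)
  also have "\<dots> = (\<Sum>k\<in>{1..n}. ?w k * (multiples_fps k * overpartition_fps) $ n)"
    by (rule sum.cong) (auto simp flip: count_fps_eq)
  also have "\<dots> = ((sigma_fps - 2 * sigma2_fps) * overpartition_fps) $ n"
    by (simp only: weighted_sum_multiples_fps[OF order.refl] odd_divisor_sum_fps)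
  finally show "Abs_fps (\<lambda>n. int (SONO n)) $ n
      = ((sigma_fps - 2 * sigma2_fps) * overpartition_fps) $ n"
    by simp
qed

text \<open>Every overpartition of \<open>n\<close> has parts of total size \<open>n\<close>, so \<open>\<theta>P\<close> counts all parts of all
  overpartitions weighted by size. The non-overlined parts contribute \<open>S P\<close>, the overlined ones
  \<open>(S - 2T) P\<close>.\<close>

lemma theta_overpartition_fps:
  "theta overpartition_fps = 2 * (sigma_fps - sigma2_fps) * overpartition_fps"
proof (rule fps_ext)
  fix n
  let ?P = overpartition_fps and ?e = "\<lambda>d. if even d then int d else 0"
  have "int n = (\<Sum>k\<in>{1..n}. int k * (int (count M k) + (if k \<in> D then 1 else 0)))"
    if DM: "(D, M) \<in> overpartitions n" for D M
  proof -
    have "\<Sum>D = (\<Sum>k\<in>{1..n}. if k \<in> D then k else 0)"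
      using overpartition_parts_bounded(1)[OF DM]
      by (intro sum.mono_neutral_cong_left) auto
    moreover have "\<Sum>\<^sub># M = (\<Sum>k\<in>{1..n}. k * count M k)"
      using overpartition_parts_bounded(2)[OF DM] by (intro sum_mset_eq_sum_count) auto
    moreover have "n = \<Sum>\<^sub># M + \<Sum>D"
      using DM by (auto simp: overpartitions_def)
    ultimately have "n = (\<Sum>k\<in>{1..n}. k * count M k + (if k \<in> D then k else 0))"
      unfolding sum.distrib by linarith
    then have "int n = int (\<Sum>k\<in>{1..n}. k * count M k + (if k \<in> D then k else 0))"
      by (rule arg_cong)
    also have "\<dots> = (\<Sum>k\<in>{1..n}. int k * (int (count M k) + (if k \<in> D then 1 else 0)))"
      unfolding of_nat_sum by (rule sum.cong) (auto simp: algebra_simps)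
    finally show ?thesis .
  qed
  then have "(\<Sum>(D, M)\<in>overpartitions n. int n) = (\<Sum>(D, M)\<in>overpartitions n.
      \<Sum>k\<in>{1..n}. int k * (int (count M k) + (if k \<in> D then 1 else 0)))"
    unfolding case_prod_unfold by (intro sum.cong) simp_all
  moreover have "theta ?P $ n = (\<Sum>(D, M)\<in>overpartitions n. int n)"
    by (simp add: theta_nth overpartition_fps_def)
  ultimately have "theta ?P $ n = (\<Sum>(D, M)\<in>overpartitions n.
      \<Sum>k\<in>{1..n}. int k * (int (count M k) + (if k \<in> D then 1 else 0)))"
    by (simp only:)
  also have "\<dots> = (\<Sum>k\<in>{1..n}. int k * (\<Sum>(D, M)\<in>overpartitions n.
      int (count M k) + (if k \<in> D then 1 else 0)))"
    unfolding case_prod_unfold sum_distrib_left by (rule sum.swap)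
  also have "\<dots> = (\<Sum>k\<in>{1..n}. int k * ((\<Sum>(D, M)\<in>overpartitions n. int (count M k))
      + (\<Sum>(D, M)\<in>overpartitions n. if k \<in> D then 1 else 0)))"
    by (simp only: case_prod_unfold sum.distrib)
  also have "\<dots> = (\<Sum>k\<in>{1..n}. int k * ((multiples_fps k * ?P) $ n
      + ((multiples_fps k - 2 * multiples_fps (2 * k)) * ?P) $ n))"
    by (rule sum.cong) (auto simp flip: count_fps_eq overlined_fps_eq)
  also have "\<dots> = 2 * (\<Sum>k\<in>{1..n}. int k * (multiples_fps k * ?P) $ n)
      - (\<Sum>k\<in>{1..n}. int (2 * k) * (multiples_fps (2 * k) * ?P) $ n)"
  proof -
    have "((multiples_fps k - 2 * multiples_fps (2 * k)) * ?P) $ n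
        = (multiples_fps k * ?P) $ n - 2 * (multiples_fps (2 * k) * ?P) $ n" for k
      by (simp add: left_diff_distrib mult.assoc numeral_fps_const)
    then show ?thesis
      unfolding sum_distrib_left sum_subtractf[symmetric]
      by (intro sum.cong) (simp_all add: algebra_simps)
  qed
  also have "(\<Sum>k\<in>{1..n}. int (2 * k) * (multiples_fps (2 * k) * ?P) $ n)
      = (\<Sum>j\<in>{j\<in>{1..2 * n}. even j}. int j * (multiples_fps j * ?P) $ n)"
    by (rule sum.reindex_bij_witness[where i = "\<lambda>j. j div 2" and j = "\<lambda>k. 2 * k"]) auto
  also have "\<dots> = (\<Sum>j\<in>{1..2 * n}. ?e j * (multiples_fps j * ?P) $ n)"
    by (rule sum.mono_neutral_cong_left) auto
  also have "\<dots> = (2 * sigma2_fps * ?P) $ n"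
    by (subst weighted_sum_multiples_fps) (simp_all add: even_divisor_sum_fps)
  also have "(\<Sum>k\<in>{1..n}. int k * (multiples_fps k * ?P) $ n) = (sigma_fps * ?P) $ n"
    by (simp only: weighted_sum_multiples_fps[OF order.refl] sigma_fps_eq_divisor_sum)
  finally show "theta ?P $ n = (2 * (sigma_fps - sigma2_fps) * ?P) $ n"
    by (simp add: left_diff_distrib right_diff_distrib mult.assoc numeral_fps_const)
qed

section \<open>The congruence\<close>

text \<open>For \<open>K = P L\<close> one has \<open>\<theta>K - 3K = P (\<theta>L + 2 (S - T) L - 3L)\<close>, and the differential equations
  turn the bracket into a polynomial in \<open>S\<close> and \<open>T\<close>. Comparing coefficients modulo \<open>5\<close>, for \<open>L\<close> of
  degree at most \<open>2\<close> this polynomial is a scalar multiple of \<open>S - 2T\<close> exactly when \<open>L\<close> is a scalar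
  multiple of \<open>2ST + T\<^sup>2 + S + T\<close>.\<close>

lemma theta_minus_3_mod_5:
  "\<exists>K W. 3 * ((sigma_fps - 2 * sigma2_fps) * overpartition_fps) = theta K - 3 * K + 5 * W"
proof -
  obtain U where U: "theta sigma_fps = 3 * sigma_fps ^ 2 + sigma_fps + 5 * U"
    using theta_sigma_fps by blast
  obtain V where V: "theta sigma2_fps = sigma2_fps ^ 2 + 2 * sigma2_fps + 5 * V"
    using theta_sigma2_fps by blast
  define P where "P = overpartition_fps"
  define S where "S = sigma_fps"
  define T where "T = sigma2_fps"
  \<comment> \<open>\<open>2ST + T\<^sup>2 + S + T\<close>, expanded into sums of products for the Leibniz rule.\<close>
  define L where "L = S * T + S * T + T * T + S + T"
  have dS: "theta S = 3 * S ^ 2 + S + 5 * U" and dT: "theta T = T ^ 2 + 2 * T + 5 * V"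
    and dP: "theta P = 2 * (S - T) * P"
    using U V theta_overpartition_fps by (simp_all add: S_def T_def P_def)
  have "3 * ((S - 2 * T) * P) = theta (P * L) - 3 * (P * L)
      + 5 * (- (P * (2 * S ^ 2 * T + S ^ 2 - S + T + (2 * T + 1) * U + (2 * S + 2 * T + 1) * V)))"
    unfolding L_def theta_mult theta_add dS dT dP
    by (simp add: algebra_simps power2_eq_square)
  then show ?thesis
    unfolding P_def S_def T_def by blast
qed

theorem theorem1p9:
  fixes n :: nat
  shows "[SONO (5 * n + 3) = 0] (mod 5)"
proof -
  obtain K W where
    "3 * ((sigma_fps - 2 * sigma2_fps) * overpartition_fps) = theta K - 3 * K + 5 * W"
    using theta_minus_3_mod_5 by blast
  then have "(3 * Abs_fps (\<lambda>n. int (SONO n))) $ (5 * n + 3)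
      = (theta K - 3 * K + 5 * W) $ (5 * n + 3)"
    by (simp only: SONO_fps)
  then have "3 * int (SONO (5 * n + 3)) = 5 * (int n * K $ (5 * n + 3) + W $ (5 * n + 3))"
    by (simp add: theta_nth numeral_fps_const algebra_simps)
  then have "int 5 dvd int (SONO (5 * n + 3))"
    by presburger
  then have "5 dvd SONO (5 * n + 3)"
    by (simp only: int_dvd_int_iff)
  then show ?thesis
    by (simp add: cong_0_iff)
qed

end
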